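(* Consider the AC optimal power flow problem $$\min\ \sum_{i\in\mathcal{N}_p}c_i^p(p_i^g)+c_i^q(q_i^g)\quad\text{s.t.}\quad(\boldsymbol{p}^g,\boldsymbol{q}^g,\boldsymbol{p},\boldsymbol{q})\in\mathcal{M}_{ACP},\quad(\boldsymbol{p},\boldsymbol{q},\boldsymbol{v},\boldsymbol{\theta},\boldsymbol{p}^l,\boldsymbol{q}^l)\in\mathcal{S}_{ACP}$$ with $\mathcal{M}_{ACP}$, $\mathcal{S}_{ACP}$ as defined in the context. Any feasible point in $\mathcal{S}_{ACP}$ at which the voltage lower bounds $\underline{v}_i\le v_i$ are not binding (i.e., $v_i>\underline{v}_i$ for all $i\in\mathcal{N}_p$) satisfies the locally star shaped (LSS) property: there exists $\epsilon\in(0,1)$ such that for all $s\in[1-\epsilon,1]$ the vector $(s\boldsymbol{p},s\boldsymbol{q})$ lies in the projection of $\mathcal{S}_{ACP}$ onto the $(\boldsymbol{p},\boldsymbol{q})$ variables. If the point is also locally optimal for the AC optimal power flow problem and the Mangasarian-Fromovitz constraint qualification (in the form given in the context) is satisfied, then it is revenue adequate, i.e., $\mathcal{R}=-\lambda^T(\boldsymbol{p},\boldsymbol{q})\ge0$, where $\lambda$ is the vector of dual variables of the constraints $p_i=p_i^g-p_i^d$, $q_i=q_i^g-q_i^d$, $i\in\mathcal{N}_p$.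
   Context: A power system is represented by a finite set of nodes $\mathcal{N}_p$ connected by lines $\mathcal{E}_p$. Given data: active and reactive loads $p_i^d,q_i^d$; generation upper bounds $\overline{p}_i^g,\overline{q}_i^g$; line conductance $g_{ij}$, susceptance $b_{ij}$, shunt susceptance $b_{ij}^{sh}$; line limits $\overline{s}_{ij}$; voltage bounds $\underline{v}_i,\overline{v}_i$; cost functions $c_i^p,c_i^q$. Variables: active and reactive generation $\boldsymbol{p}^g,\boldsymbol{q}^g$; net active and reactive injections $\boldsymbol{p}=(p_i)$, $\boldsymbol{q}=(q_i)$; voltage magnitudes $\boldsymbol{v}=(v_i)$ (nonnegative) and voltage phase angles $\boldsymbol{\theta}=(\theta_i)$; active and reactive line flows $\boldsymbol{p}^l=(p_{ij}^l)$, $\boldsymbol{q}^l=(q_{ij}^l)$, $(ij)\in\mathcal{E}_p$, with the convention $p_{ji}^l=-p_{ij}^l$, $q_{ji}^l=-q_{ij}^l$. $\partial i$ is the set of neighbors of $i$. $$\mathcal{M}_{ACP}=\{(\boldsymbol{p}^g,\boldsymbol{q}^g,\boldsymbol{p},\boldsymbol{q})\mid p_i=p_i^g-p_i^d,\ q_i=q_i^g-q_i^d,\ 0\le p_i^g\le\overline{p}_i^g,\ 0\le q_i^g\le\overline{q}_i^g\ \ \forall i\in\mathcal{N}_p\}.$$ $\mathcal{S}_{ACP}$ is the set of $(\boldsymbol{p},\boldsymbol{q},\boldsymbol{v},\boldsymbol{\theta},\boldsymbol{p}^l,\boldsymbol{q}^l)$ such that - $\sum_{j\in\partial i}p_{ij}^l=p_i$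 and $\sum_{j\in\partial i}q_{ij}^l=q_i$ for all $i\in\mathcal{N}_p$; - $p_{ij}^l=g_{ij}v_i^2-g_{ij}v_iv_j\cos(\theta_i-\theta_j)-b_{ij}v_iv_j\sin(\theta_i-\theta_j)$ for all $(ij)\in\mathcal{E}_p$; - $q_{ij}^l=-\left(b_{ij}+\tfrac{b_{ij}^{sh}}{2}\right)v_i^2+b_{ij}v_iv_j\cos(\theta_i-\theta_j)-g_{ij}v_iv_j\sin(\theta_i-\theta_j)$ for all $(ij)\in\mathcal{E}_p$; - $(p_{ij}^l)^2+(q_{ij}^l)^2\le\overline{s}_{ij}^2$ for all $(ij)\in\mathcal{E}_p$; - $\underline{v}_i\le v_i\le\overline{v}_i$ for all $i\in\mathcal{N}_p$. General form: this is the instance $q\to(\boldsymbol{p}^g,\boldsymbol{q}^g)$, $x\to(\boldsymbol{p},\boldsymbol{q})$, $y\to(\boldsymbol{v},\boldsymbol{\theta},\boldsymbol{p}^l,\boldsymbol{q}^l)$, $d\to(p^d,q^d)$ of $\min c(q)$ s.t. $\underline{q}\le q\le\overline{q}$, $x=q-d$, $H(x,y)=0$, $G(x,y)\le0$, where $H=(h_j)_{j=1}^{N_h}$ collects the equality constraints of $\mathcal{S}_{ACP}$ and $G=(g_i)_{i=1}^{N_g}$ its inequality constraints. The Lagrangian is $c(q)+\underline{\mu}^T(\underline{q}-q)+\overline{\mu}^T(q-\overline{q})+\lambda^T(x-q+d)+\nu_i^TG(x,y)+\nu_e^TH(x,y)$, with $\underline{\mu},\overline{\mu},\nu_i\ge0$;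 the dual variables at a local optimum are multipliers satisfying the KKT conditions (stationarity in $q,x,y$, dual feasibility and complementary slackness). Mangasarian-Fromovitz constraint qualification: the gradients of the equality constraints are linearly independent at $(q,x,y)$, and there exists a vector $\delta$ in the space of the $(x,y)$ variables such that $\nabla g_i(x,y)^T\delta<0$ for all inequality constraints $i=1,\dots,N_g$ and $\nabla h_j(x,y)^T\delta=0$ for all $j=1,\dots,N_h$. The net revenue is $\mathcal{R}=\lambda^T(d-q)=-\lambda^Tx$, and revenue adequacy means $\mathcal{R}\ge0$. *)

theory Defs
  imports "HOL-Analysis.Analysis"
begin

section \<open>Optimization problems in general form\<close>

text \<open>
  The problem is to minimize \<open>c q\<close> subject to \<open>ql \<le> q \<le> qu\<close>, \<open>x = q - d\<close>,
  \<open>H j (x, y) = 0\<close> for \<open>j \<in> J\<close> and \<open>G i (x, y) \<le> 0\<close> for \<open>i \<in> I\<close>.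
  Coordinates of \<open>q\<close> and \<open>x\<close> are taken with respect to \<^const>\<open>Basis\<close>.
\<close>

definition lagrangian ::
  "('a::euclidean_space \<Rightarrow> real) \<Rightarrow> 'a \<Rightarrow> 'a \<Rightarrow> 'a \<Rightarrow>
   'i set \<Rightarrow> ('i \<Rightarrow> 'a \<times> 'b::euclidean_space \<Rightarrow> real) \<Rightarrow>
   'j set \<Rightarrow> ('j \<Rightarrow> 'a \<times> 'b \<Rightarrow> real) \<Rightarrow>
   'a \<Rightarrow> 'a \<Rightarrow> 'a \<Rightarrow> ('i \<Rightarrow> real) \<Rightarrow> ('j \<Rightarrow> real) \<Rightarrow> 'a \<times> 'a \<times> 'b \<Rightarrow> real"
  where
  "lagrangian c ql qu d I G J H \<mu>l \<mu>u lam \<nu>i \<nu>e = (\<lambda>(q, x, y).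
     c q + \<mu>l \<bullet> (ql - q) + \<mu>u \<bullet> (q - qu) + lam \<bullet> (x - q + d)
     + (\<Sum>i\<in>I. \<nu>i i * G i (x, y)) + (\<Sum>j\<in>J. \<nu>e j * H j (x, y)))"

text \<open>
  Stationarity in \<open>q\<close>, \<open>x\<close> and \<open>y\<close> is stated jointly: the Lagrangian has derivative zero.
  In particular, \<open>c\<close> is differentiable at \<open>q\<close> whenever the constraint functions are
  differentiable there.
\<close>

definition kkt_multipliers ::
  "('a::euclidean_space \<Rightarrow> real) \<Rightarrow> 'a \<Rightarrow> 'a \<Rightarrow> 'a \<Rightarrow>
   'i set \<Rightarrow> ('i \<Rightarrow> 'a \<times> 'b::euclidean_space \<Rightarrow> real) \<Rightarrow>
   'j set \<Rightarrow> ('j \<Rightarrow> 'a \<times> 'b \<Rightarrow> real) \<Rightarrow> 'a \<times> 'a \<times> 'b \<Rightarrow>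
   'a \<Rightarrow> 'a \<Rightarrow> 'a \<Rightarrow> ('i \<Rightarrow> real) \<Rightarrow> ('j \<Rightarrow> real) \<Rightarrow> bool"
  where
  "kkt_multipliers c ql qu d I G J H = (\<lambda>(q, x, y) \<mu>l \<mu>u lam \<nu>i \<nu>e.
     (lagrangian c ql qu d I G J H \<mu>l \<mu>u lam \<nu>i \<nu>e has_derivative (\<lambda>_. 0)) (at (q, x, y)) \<and>
     (\<forall>b\<in>Basis. 0 \<le> \<mu>l \<bullet> b \<and> 0 \<le> \<mu>u \<bullet> b) \<and> (\<forall>i\<in>I. 0 \<le> \<nu>i i) \<and>
     (\<forall>b\<in>Basis. (\<mu>l \<bullet> b) * ((ql - q) \<bullet> b) = 0 \<and> (\<mu>u \<bullet> b) * ((q - qu) \<bullet> b) = 0) \<and>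
     (\<forall>i\<in>I. \<nu>i i * G i (x, y) = 0))"

definition grad :: "('a::real_inner \<Rightarrow> real) \<Rightarrow> 'a \<Rightarrow> 'a"
  where "grad f z = (THE D. GDERIV f z :> D)"

text \<open>
  The equality constraints are those of the coupling \<open>x - q + d = 0\<close> together with \<open>H = 0\<close>;
  their gradients are taken in the space of \<open>(q, x, y)\<close>. The gradients are required to be
  linearly independent as a family, so repeated gradients count as dependent.
\<close>

definition mfcq ::
  "'a::euclidean_space \<Rightarrow> 'i set \<Rightarrow> ('i \<Rightarrow> 'a \<times> 'b::euclidean_space \<Rightarrow> real) \<Rightarrow>
   'j set \<Rightarrow> ('j \<Rightarrow> 'a \<times> 'b \<Rightarrow> real) \<Rightarrow> 'a \<times> 'a \<times> 'b \<Rightarrow> bool"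
  where
  "mfcq d I G J H = (\<lambda>(q, x, y).
     (\<forall>\<alpha> \<beta>.
        (\<Sum>b\<in>Basis. \<alpha> b *\<^sub>R grad (\<lambda>(q', x', y'). (x' - q' + d) \<bullet> b) (q, x, y))
        + (\<Sum>j\<in>J. \<beta> j *\<^sub>R grad (\<lambda>(q', x', y'). H j (x', y')) (q, x, y)) = 0
        \<longrightarrow> (\<forall>b\<in>Basis. \<alpha> b = 0) \<and> (\<forall>j\<in>J. \<beta> j = 0)) \<and>
     (\<exists>\<delta>. (\<forall>i\<in>I. grad (G i) (x, y) \<bullet> \<delta> < 0) \<and> (\<forall>j\<in>J. grad (H j) (x, y) \<bullet> \<delta> = 0)))"

definition net_revenue :: "'a::real_inner \<Rightarrow> 'a \<Rightarrow> real"
  where "net_revenue lam x = - (lam \<bullet> x)"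

definition locally_star_shaped_at :: "('a::real_vector \<times> 'b) set \<Rightarrow> 'a \<Rightarrow> bool"
  where
  "locally_star_shaped_at S x \<longleftrightarrow>
     (\<exists>\<epsilon>\<in>{0<..<1}. \<forall>s\<in>{1 - \<epsilon>..1}. s *\<^sub>R x \<in> fst ` S)"

section \<open>AC optimal power flow\<close>

text \<open>
  The nodes are the elements of the finite type \<open>'n\<close>. Every line is listed once in \<open>lines\<close>,
  as an ordered pair giving its reference orientation.
\<close>

record ('n::finite) ac_network =
  lines :: "('n \<times> 'n) set"
  load_p :: "real ^ 'n"
  load_q :: "real ^ 'n"
  gen_p_max :: "real ^ 'n"
  gen_q_max :: "real ^ 'n"
  conductance :: "'n \<Rightarrow> 'n \<Rightarrow> real"
  susceptance :: "'n \<Rightarrow> 'n \<Rightarrow> real"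
  shunt_susceptance :: "'n \<Rightarrow> 'n \<Rightarrow> real"
  line_limit :: "'n \<Rightarrow> 'n \<Rightarrow> real"
  v_min :: "real ^ 'n"
  v_max :: "real ^ 'n"
  cost_p :: "'n \<Rightarrow> real \<Rightarrow> real"
  cost_q :: "'n \<Rightarrow> real \<Rightarrow> real"

text \<open>
  Injections (or generations) are pairs \<open>(p, q)\<close>. The remaining variables are
  \<open>(v, \<theta>, pl, ql)\<close>, where \<open>pl\<close> and \<open>ql\<close> are indexed by all pairs of nodes so that they
  live in a Euclidean space; only the coordinates belonging to \<open>lines\<close> are ever used.
\<close>

type_synonym 'n injection = "(real ^ 'n) \<times> (real ^ 'n)"
type_synonym 'n grid_state =
  "(real ^ 'n) \<times> (real ^ 'n) \<times> (real ^ ('n \<times> 'n)) \<times> (real ^ ('n \<times> 'n))"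

definition neighbours :: "'n::finite ac_network \<Rightarrow> 'n \<Rightarrow> 'n set"
  where "neighbours N i = {j. (i, j) \<in> lines N \<or> (j, i) \<in> lines N}"

text \<open>Against the reference orientation, a flow is the negative of the flow along it.\<close>

definition flow :: "'n::finite ac_network \<Rightarrow> real ^ ('n \<times> 'n) \<Rightarrow> 'n \<Rightarrow> 'n \<Rightarrow> real"
  where "flow N f i j = (if (i, j) \<in> lines N then f $ (i, j) else - f $ (j, i))"

definition line_p :: "'n::finite ac_network \<Rightarrow> real ^ 'n \<Rightarrow> real ^ 'n \<Rightarrow> 'n \<Rightarrow> 'n \<Rightarrow> real"
  where
  "line_p N v \<theta> i j =
     conductance N i j * (v $ i)\<^sup>2
     - conductance N i j * v $ i * v $ j * cos (\<theta> $ i - \<theta> $ j)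
     - susceptance N i j * v $ i * v $ j * sin (\<theta> $ i - \<theta> $ j)"

definition line_q :: "'n::finite ac_network \<Rightarrow> real ^ 'n \<Rightarrow> real ^ 'n \<Rightarrow> 'n \<Rightarrow> 'n \<Rightarrow> real"
  where
  "line_q N v \<theta> i j =
     - (susceptance N i j + shunt_susceptance N i j / 2) * (v $ i)\<^sup>2
     + susceptance N i j * v $ i * v $ j * cos (\<theta> $ i - \<theta> $ j)
     - conductance N i j * v $ i * v $ j * sin (\<theta> $ i - \<theta> $ j)"

definition M_ACP :: "'n::finite ac_network \<Rightarrow> ('n injection \<times> 'n injection) set"
  where
  "M_ACP N = {((pg, qg), (p, q)). \<forall>i.
     p $ i = pg $ i - load_p N $ i \<and> q $ i = qg $ i - load_q N $ i \<and>
     0 \<le> pg $ i \<and> pg $ i \<le> gen_p_max N $ i \<and>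
     0 \<le> qg $ i \<and> qg $ i \<le> gen_q_max N $ i}"

text \<open>Voltage magnitudes are nonnegative by nature; this is the first condition.\<close>

definition S_ACP :: "'n::finite ac_network \<Rightarrow> ('n injection \<times> 'n grid_state) set"
  where
  "S_ACP N = {((p, q), (v, \<theta>, pl, ql)).
     (\<forall>i. 0 \<le> v $ i) \<and>
     (\<forall>i. (\<Sum>j\<in>neighbours N i. flow N pl i j) = p $ i \<and>
          (\<Sum>j\<in>neighbours N i. flow N ql i j) = q $ i) \<and>
     (\<forall>(i, j)\<in>lines N. pl $ (i, j) = line_p N v \<theta> i j) \<and>
     (\<forall>(i, j)\<in>lines N. ql $ (i, j) = line_q N v \<theta> i j) \<and>
     (\<forall>(i, j)\<in>lines N. (pl $ (i, j))\<^sup>2 + (ql $ (i, j))\<^sup>2 \<le> (line_limit N i j)\<^sup>2) \<and>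
     (\<forall>i. v_min N $ i \<le> v $ i \<and> v $ i \<le> v_max N $ i)}"

definition gen_cost :: "'n::finite ac_network \<Rightarrow> 'n injection \<Rightarrow> real"
  where "gen_cost N = (\<lambda>(pg, qg). \<Sum>i\<in>UNIV. cost_p N i (pg $ i) + cost_q N i (qg $ i))"

definition ac_feasible ::
  "'n::finite ac_network \<Rightarrow> ('n injection \<times> 'n injection \<times> 'n grid_state) set"
  where "ac_feasible N = {(g, x, y). (g, x) \<in> M_ACP N \<and> (x, y) \<in> S_ACP N}"

definition ac_local_opt ::
  "'n::finite ac_network \<Rightarrow> 'n injection \<times> 'n injection \<times> 'n grid_state \<Rightarrow> bool"
  where
  "ac_local_opt N z \<longleftrightarrow> z \<in> ac_feasible N \<and>
     (\<exists>r>0. \<forall>z'\<in>ac_feasible N. dist z' z < r \<longrightarrow> gen_cost N (fst z) \<le> gen_cost N (fst z'))"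

subsection \<open>The problem in general form\<close>

datatype 'n eq_con =
    Balance_P 'n | Balance_Q 'n | Flow_P 'n 'n | Flow_Q 'n 'n

datatype 'n ineq_con =
    Line_Limit 'n 'n | Volt_Lower 'n | Volt_Upper 'n

definition eq_cons :: "'n::finite ac_network \<Rightarrow> 'n eq_con set"
  where
  "eq_cons N = range Balance_P \<union> range Balance_Q
     \<union> (\<lambda>(i, j). Flow_P i j) ` lines N \<union> (\<lambda>(i, j). Flow_Q i j) ` lines N"

definition ineq_cons :: "'n::finite ac_network \<Rightarrow> 'n ineq_con set"
  where
  "ineq_cons N = (\<lambda>(i, j). Line_Limit i j) ` lines N
     \<union> range Volt_Lower \<union> range Volt_Upper"

fun eq_fun :: "'n::finite ac_network \<Rightarrow> 'n eq_con \<Rightarrow> 'n injection \<times> 'n grid_state \<Rightarrow> real"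
  where
  "eq_fun N (Balance_P i) ((p, q), (v, \<theta>, pl, ql)) = (\<Sum>j\<in>neighbours N i. flow N pl i j) - p $ i"
| "eq_fun N (Balance_Q i) ((p, q), (v, \<theta>, pl, ql)) = (\<Sum>j\<in>neighbours N i. flow N ql i j) - q $ i"
| "eq_fun N (Flow_P i j) ((p, q), (v, \<theta>, pl, ql)) = pl $ (i, j) - line_p N v \<theta> i j"
| "eq_fun N (Flow_Q i j) ((p, q), (v, \<theta>, pl, ql)) = ql $ (i, j) - line_q N v \<theta> i j"

fun ineq_fun :: "'n::finite ac_network \<Rightarrow> 'n ineq_con \<Rightarrow> 'n injection \<times> 'n grid_state \<Rightarrow> real"
  where
  "ineq_fun N (Line_Limit i j) ((p, q), (v, \<theta>, pl, ql)) =
     (pl $ (i, j))\<^sup>2 + (ql $ (i, j))\<^sup>2 - (line_limit N i j)\<^sup>2"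
| "ineq_fun N (Volt_Lower i) ((p, q), (v, \<theta>, pl, ql)) = v_min N $ i - v $ i"
| "ineq_fun N (Volt_Upper i) ((p, q), (v, \<theta>, pl, ql)) = v $ i - v_max N $ i"

lemma S_ACP_iff:
  "(x, (v, \<theta>, pl, ql)) \<in> S_ACP N \<longleftrightarrow>
     (\<forall>i. 0 \<le> v $ i) \<and>
     (\<forall>j\<in>eq_cons N. eq_fun N j (x, (v, \<theta>, pl, ql)) = 0) \<and>
     (\<forall>i\<in>ineq_cons N. ineq_fun N i (x, (v, \<theta>, pl, ql)) \<le> 0)"
  by (cases x) (auto simp: S_ACP_def eq_cons_def ineq_cons_def ball_Un case_prod_beta)

definition ac_kkt_multipliers ::
  "'n::finite ac_network \<Rightarrow> 'n injection \<times> 'n injection \<times> 'n grid_state \<Rightarrow>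
   'n injection \<Rightarrow> 'n injection \<Rightarrow> 'n injection \<Rightarrow> ('n ineq_con \<Rightarrow> real) \<Rightarrow> ('n eq_con \<Rightarrow> real) \<Rightarrow> bool"
  where
  "ac_kkt_multipliers N =
     kkt_multipliers (gen_cost N) 0 (gen_p_max N, gen_q_max N) (load_p N, load_q N)
       (ineq_cons N) (ineq_fun N) (eq_cons N) (eq_fun N)"

text \<open>
  The strict decrease condition over all inequality constraints cannot hold here, because
  the two voltage bounds at a node have opposite gradients. The usual condition, over the
  active inequality constraints only, is therefore provided as well; it is the weaker one.
\<close>

definition ac_mfcq ::
  "'n::finite ac_network \<Rightarrow> 'n injection \<times> 'n injection \<times> 'n grid_state \<Rightarrow> bool"
  where
  "ac_mfcq N = mfcq (load_p N, load_q N) (ineq_cons N) (ineq_fun N) (eq_cons N) (eq_fun N)"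

definition ac_mfcq_active ::
  "'n::finite ac_network \<Rightarrow> 'n injection \<times> 'n injection \<times> 'n grid_state \<Rightarrow> bool"
  where
  "ac_mfcq_active N z =
     mfcq (load_p N, load_q N) {i \<in> ineq_cons N. ineq_fun N i (snd z) = 0} (ineq_fun N)
       (eq_cons N) (eq_fun N) z"

end

(* Scaling the injections and line flows by s and the voltage magnitudes by sqrt s, with the
   angles fixed, preserves all equality constraints, since the flow equations are homogeneous
   of degree two in the voltages. For s \<le> 1 the line limits and upper voltage bounds are
   preserved too, and slack lower voltage bounds survive for s near 1.
   Revenue adequacy follows by differentiating the Lagrangian along this path at s = 1, where
   its derivative vanishes: the line-limit and upper voltage bound functions are nondecreasing
   in s, and the multipliers of the slack lower voltage bounds are zero, so what remains gives
   lam \<bullet> x \<le> 0. *)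
theory Submission
  imports Defs
begin

text \<open>The generation \<open>q\<close> stays fixed along the path, so cost and generation
  bounds contribute nothing to the derivative; only the coupling term and the inequality terms
  survive. Derivatives of \<open>G i\<close> are required only at active constraints, since
  complementary slackness removes the others.\<close>

lemma kkt_net_revenue_nonneg:
  fixes x :: "'a::euclidean_space" and y :: "'b::euclidean_space"
    and Y :: "real \<Rightarrow> 'b" and D :: "'i \<Rightarrow> real"
  assumes kkt: "kkt_multipliers c ql qu d I G J H (q, x, y) \<mu>l \<mu>u lam \<nu>i \<nu>e"
    and "finite J"
    and Y: "Y 1 = y" "(Y has_vector_derivative Y') (at 1)"
    and H: "\<And>j. j \<in> J \<Longrightarrow> \<forall>\<^sub>F s in nhds 1. H j (s *\<^sub>R x, Y s) = 0"
    and G: "\<And>i. i \<in> I \<Longrightarrow> G i (x, y) = 0 \<Longrightarrow>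
      0 \<le> D i \<and> ((\<lambda>s. G i (s *\<^sub>R x, Y s)) has_real_derivative D i) (at 1)"
  shows "0 \<le> net_revenue lam x"
proof -
  define L where "L = lagrangian c ql qu d I G J H \<mu>l \<mu>u lam \<nu>i \<nu>e"
  define \<phi> where "\<phi> s = L (q, s *\<^sub>R x, Y s)" for s
  have L': "(L has_derivative (\<lambda>_. 0)) (at (q, x, y))"
    and nu: "\<And>i. i \<in> I \<Longrightarrow> 0 \<le> \<nu>i i" "\<And>i. i \<in> I \<Longrightarrow> \<nu>i i * G i (x, y) = 0"
    using kkt by (auto simp: kkt_multipliers_def L_def)
  have "((\<lambda>s. (q, s *\<^sub>R x, Y s)) has_derivative (\<lambda>h. (0, h *\<^sub>R x, h *\<^sub>R Y'))) (at 1)"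
    using Y(2) unfolding has_vector_derivative_def
    by (auto intro!: derivative_eq_intros)
  then have "((\<lambda>s. L (q, s *\<^sub>R x, Y s)) has_derivative (\<lambda>_. 0)) (at 1)"
    by (rule has_derivative_compose[where g = L and g' = "\<lambda>_. 0"]) (use L' Y(1) in simp)
  then have zero: "(\<phi> has_real_derivative 0) (at 1)"
    by (simp add: \<phi>_def[abs_def] has_field_derivative_def lambda_zero)
  \<comment> \<open>\<open>K\<close> gathers what is constant along the path:
    \<open>lam \<bullet> (s *\<^sub>R x - q + d)\<close> splits into
    \<open>s * (lam \<bullet> x)\<close> and a constant.\<close>
  define K where "K = c q + \<mu>l \<bullet> (ql - q) + \<mu>u \<bullet> (q - qu) + lam \<bullet> (d - q)"
  have "\<forall>\<^sub>F s in nhds 1. \<forall>j\<in>J. H j (s *\<^sub>R x, Y s) = 0"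
    using \<open>finite J\<close> H by (simp add: eventually_ball_finite)
  then have ev: "\<forall>\<^sub>F s in nhds 1.
      \<phi> s = K + s * (lam \<bullet> x) + (\<Sum>i\<in>I. \<nu>i i * G i (s *\<^sub>R x, Y s))"
    by eventually_elim
      (simp add: \<phi>_def L_def lagrangian_def K_def inner_add_right inner_diff_right)
  have "((\<lambda>s. \<nu>i i * G i (s *\<^sub>R x, Y s)) has_real_derivative \<nu>i i * D i) (at 1)"
    if "i \<in> I" for i
  \<comment> \<open>A zero multiplier makes the product constantly 0, whatever \<open>G i\<close>
    does along the path, so \<open>D i\<close> may be arbitrary there.\<close>
  proof (cases "\<nu>i i = 0")
    case False
    then have "G i (x, y) = 0" using nu(2)[OF that] by simp
    with G[OF that] show ?thesis by (auto intro: DERIV_cmult)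
  qed simp
  then have "((\<lambda>s. \<Sum>i\<in>I. \<nu>i i * G i (s *\<^sub>R x, Y s))
      has_real_derivative (\<Sum>i\<in>I. \<nu>i i * D i)) (at 1)"
    by (rule DERIV_sum)
  then have "((\<lambda>s. K + s * (lam \<bullet> x) + (\<Sum>i\<in>I. \<nu>i i * G i (s *\<^sub>R x, Y s)))
      has_real_derivative lam \<bullet> x + (\<Sum>i\<in>I. \<nu>i i * D i)) (at 1)"
    by (rule DERIV_add[rotated]) (auto intro!: derivative_eq_intros)
  then have "(\<phi> has_real_derivative lam \<bullet> x + (\<Sum>i\<in>I. \<nu>i i * D i)) (at 1)"
    using DERIV_cong_ev[OF refl ev refl] by simp
  with zero have "lam \<bullet> x + (\<Sum>i\<in>I. \<nu>i i * D i) = 0"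
    using DERIV_unique by force
  moreover have "0 \<le> (\<Sum>i\<in>I. \<nu>i i * D i)"
  proof (rule sum_nonneg)
    fix i assume "i \<in> I"
    then show "0 \<le> \<nu>i i * D i"
      using nu[of i] G[of i] by (cases "\<nu>i i = 0") auto
  qed
  ultimately show ?thesis by (simp add: net_revenue_def)
qed

lemma line_p_scaleR: "line_p N (t *\<^sub>R v) \<theta> i j = t\<^sup>2 * line_p N v \<theta> i j"
  by (simp add: line_p_def algebra_simps power2_eq_square)

lemma line_q_scaleR: "line_q N (t *\<^sub>R v) \<theta> i j = t\<^sup>2 * line_q N v \<theta> i j"
  by (simp add: line_q_def algebra_simps power2_eq_square)

lemma flow_scaleR: "flow N (s *\<^sub>R f) i j = s * flow N f i j"
  by (simp add: flow_def)

definition scaled_state :: "real \<Rightarrow> 'n::finite grid_state \<Rightarrow> 'n grid_state"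
  where "scaled_state s = (\<lambda>(v, \<theta>, pl, ql). (sqrt s *\<^sub>R v, \<theta>, s *\<^sub>R pl, s *\<^sub>R ql))"

lemma scaled_state_1: "scaled_state 1 y = y"
  by (cases y) (simp add: scaled_state_def)

lemma scaled_state_has_vector_derivative:
  "((\<lambda>s. scaled_state s (v, \<theta>, pl, ql)) has_vector_derivative ((1/2) *\<^sub>R v, 0, pl, ql)) (at 1)"
  unfolding scaled_state_def has_vector_derivative_def
  by (auto intro!: derivative_eq_intros)

text \<open>Balance equations are linear in injections and flows, and \<open>sqrt s\<close> squares
  to \<open>s\<close> in the flow equations, so every residual scales by \<open>s\<close>.\<close>

lemma eq_fun_scaled:
  assumes "0 \<le> s"
  shows "eq_fun N j (s *\<^sub>R x, scaled_state s y) = s * eq_fun N j (x, y)"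
  using assms
  by (cases x; cases y; cases j)
    (simp_all add: scaled_state_def line_p_scaleR line_q_scaleR flow_scaleR
      sum_distrib_left algebra_simps)

text \<open>Shrinking multiplies squared line flows by s^2 \<le> 1 and, voltages being nonnegative,
  lowers their magnitudes. Only the lower voltage bounds can break, hence the hypothesis
  \<open>lower\<close>.\<close>

lemma scaled_mem_S_ACP:
  assumes mem: "(x, (v, \<theta>, pl, ql)) \<in> S_ACP N"
    and s: "0 \<le> s" "s \<le> 1"
    and lower: "\<And>i. v_min N $ i \<le> sqrt s * v $ i"
  shows "(s *\<^sub>R x, scaled_state s (v, \<theta>, pl, ql)) \<in> S_ACP N"
proof -
  let ?y = "(v, \<theta>, pl, ql)"
  have v: "0 \<le> v $ i"
    and eq: "j \<in> eq_cons N \<Longrightarrow> eq_fun N j (x, ?y) = 0"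
    and ineq: "k \<in> ineq_cons N \<Longrightarrow> ineq_fun N k (x, ?y) \<le> 0" for j k i
    using mem by (auto simp: S_ACP_iff)
  have "ineq_fun N k (s *\<^sub>R x, scaled_state s ?y) \<le> 0" if "k \<in> ineq_cons N" for k
  proof (cases k)
    case (Line_Limit i j)
    let ?S = "(pl $ (i, j))\<^sup>2 + (ql $ (i, j))\<^sup>2"
    have "(s * pl $ (i, j))\<^sup>2 + (s * ql $ (i, j))\<^sup>2 = s\<^sup>2 * ?S"
      by (simp add: power_mult_distrib algebra_simps)
    also have "\<dots> \<le> ?S"
      using s by (simp add: mult_left_le_one_le power_le_one)
    finally show ?thesis
      using ineq[OF that] Line_Limit by (cases x) (simp add: scaled_state_def)
  next
    case (Volt_Lower i)
    then show ?thesis using lower by (cases x) (simp add: scaled_state_def)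
  next
    case (Volt_Upper i)
    have "sqrt s * v $ i \<le> v $ i"
      using s v by (simp add: mult_left_le_one_le)
    then show ?thesis
      using ineq[OF that] Volt_Upper by (cases x) (simp add: scaled_state_def)
  qed
  moreover have "eq_fun N j (s *\<^sub>R x, scaled_state s ?y) = 0" if "j \<in> eq_cons N" for j
    using eq[OF that] s by (simp add: eq_fun_scaled)
  ultimately show ?thesis
    using v s by (simp add: scaled_state_def S_ACP_iff)
qed

lemma S_ACP_locally_star_shaped_at:
  assumes mem: "(x, (v, \<theta>, pl, ql)) \<in> S_ACP N"
    and lower: "\<And>i. v_min N $ i < v $ i"
  shows "locally_star_shaped_at (S_ACP N) x"
proof -
  \<comment> \<open>Continuity of \<open>sqrt\<close> at 1 preserves each strict bound near 1; as
    there are finitely many nodes, one radius \<open>r\<close> serves all.\<close>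
  have "\<forall>\<^sub>F s in nhds 1. v_min N $ i < sqrt s * v $ i" for i
  proof -
    have "((\<lambda>s. sqrt s * v $ i) \<longlongrightarrow> sqrt 1 * v $ i) (nhds 1)"
      by (intro tendsto_intros filterlim_ident)
    then show ?thesis using lower[of i] by (intro order_tendstoD(1)) auto
  qed
  then have "\<forall>\<^sub>F s in nhds 1. \<forall>i. v_min N $ i < sqrt s * v $ i"
    by (simp add: eventually_all_finite)
  then obtain r where r: "0 < r"
    "\<And>s i. dist s 1 < r \<Longrightarrow> v_min N $ i < sqrt s * v $ i"
    unfolding eventually_nhds_metric by blast
  \<comment> \<open>Halving stays strictly within \<open>r\<close>; the cap at 1 keeps
    \<open>s\<close> at least 1/2.\<close>
  define \<epsilon> where "\<epsilon> = min r 1 / 2"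
  have "s *\<^sub>R x \<in> fst ` S_ACP N" if "s \<in> {1 - \<epsilon>..1}" for s
  proof -
    have "0 \<le> s" "s \<le> 1" "dist s 1 < r"
      using that r(1) by (auto simp: \<epsilon>_def dist_real_def)
    with scaled_mem_S_ACP[OF mem, of s] r(2)[of s] show ?thesis
      by (force simp: less_imp_le)
  qed
  moreover have "\<epsilon> \<in> {0<..<1}" using r(1) by (auto simp: \<epsilon>_def)
  ultimately show ?thesis unfolding locally_star_shaped_at_def by blast
qed

lemma ac_kkt_net_revenue_nonneg:
  fixes v :: "real ^ 'n::finite"
  assumes mem: "((p, q), (v, \<theta>, pl, ql)) \<in> S_ACP N"
    and lower: "\<And>i. v_min N $ i < v $ i"
    and kkt: "ac_kkt_multipliers N (g, (p, q), (v, \<theta>, pl, ql)) \<mu>l \<mu>u lam \<nu>i \<nu>e"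
  shows "0 \<le> net_revenue lam (p, q)"
proof (rule kkt_net_revenue_nonneg[OF kkt[unfolded ac_kkt_multipliers_def]])
  let ?y = "(v, \<theta>, pl, ql)"
  \<comment> \<open>Derivatives at s = 1 of s^2 times the squared flow and of
    \<open>sqrt s * v $ i\<close>. The 0 for \<open>Volt_Lower\<close> is a placeholder: that
    constraint is never active.\<close>
  define D where "D k = (case k of
      Line_Limit i j \<Rightarrow> 2 * ((pl $ (i, j))\<^sup>2 + (ql $ (i, j))\<^sup>2)
    | Volt_Lower i \<Rightarrow> 0
    | Volt_Upper i \<Rightarrow> v $ i / 2)" for k
  show "finite (eq_cons N)"
    by (simp add: eq_cons_def)
  show "scaled_state 1 ?y = ?y"
    by (rule scaled_state_1)
  show "((\<lambda>s. scaled_state s ?y) has_vector_derivative ((1/2) *\<^sub>R v, 0, pl, ql)) (at 1)"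
    by (rule scaled_state_has_vector_derivative)
  show "\<forall>\<^sub>F s in nhds 1. eq_fun N j (s *\<^sub>R (p, q), scaled_state s ?y) = 0"
    if "j \<in> eq_cons N" for j
  proof -
    have "eq_fun N j ((p, q), ?y) = 0"
      using mem that by (simp add: S_ACP_iff)
    \<comment> \<open>Differentiating at 1 needs the equalities on both sides of 1. They hold for s
      > 1 too, where the inequalities may fail.\<close>
    moreover have "\<forall>\<^sub>F s in nhds (1::real). 0 < s"
      using eventually_nhds_in_open[of "{0<..}" "1::real"] by simp
    ultimately show ?thesis
      by (auto elim!: eventually_mono simp: eq_fun_scaled simp del: scaleR_Pair)
  qed
  show "0 \<le> D k \<and>
      ((\<lambda>s. ineq_fun N k (s *\<^sub>R (p, q), scaled_state s ?y)) has_real_derivative D k) (at 1)"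
    if "k \<in> ineq_cons N" "ineq_fun N k ((p, q), ?y) = 0" for k
  proof (cases k)
    case (Line_Limit i j)
    then show ?thesis
      by (auto simp: D_def scaled_state_def power2_eq_square intro!: derivative_eq_intros)
  next
    case (Volt_Lower i)
    then show ?thesis using that lower[of i] by simp
  next
    case (Volt_Upper i)
    have "0 \<le> v $ i" using mem by (simp add: S_ACP_iff)
    with Volt_Upper show ?thesis
      by (auto simp: D_def scaled_state_def intro!: derivative_eq_intros)
  qed
qed

theorem theorem4:
  fixes N :: "'n::finite ac_network"
    and p q v \<theta> :: "real ^ 'n"
    and pl ql :: "real ^ ('n \<times> 'n)"
  assumes "asym (lines N)"
    and "((p, q), (v, \<theta>, pl, ql)) \<in> S_ACP N"
    and "\<forall>i. v_min N $ i < v $ i"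
  shows "locally_star_shaped_at (S_ACP N) (p, q) \<and>
    (\<forall>pg qg.
       ac_local_opt N ((pg, qg), (p, q), (v, \<theta>, pl, ql)) \<longrightarrow>
       ac_mfcq N ((pg, qg), (p, q), (v, \<theta>, pl, ql)) \<or>
         ac_mfcq_active N ((pg, qg), (p, q), (v, \<theta>, pl, ql)) \<longrightarrow>
       (\<forall>\<mu>l \<mu>u lam \<nu>i \<nu>e.
          ac_kkt_multipliers N ((pg, qg), (p, q), (v, \<theta>, pl, ql)) \<mu>l \<mu>u lam \<nu>i \<nu>e \<longrightarrow>
          net_revenue lam (p, q) \<ge> 0))"
  using S_ACP_locally_star_shaped_at[OF assms(2)] ac_kkt_net_revenue_nonneg[OF assms(2)] assms(3)
  by blast

end
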